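(* Let $K\ge2$, $0<v_1<\dots<v_K$, let $x^*$ be the aggregated market and $\beta\in[0,1]$. The maximum producer utility over all segmentations (and optimal pricing rules) under the privacy mechanism with parameter $\beta$ is at most that in the non-private case $\beta=0$: $$\max\{u_p:(u_c,u_p)\in\mathcal S_\beta\}\ \le\ \max\{u_p:(u_c,u_p)\in\mathcal S_0\}.$$
   Context: $\mathcal V=\{v_1,\dots,v_K\}$; a market is a probability distribution $x$ on $\mathcal V$; $\mathcal X$ is the simplex of all markets, $\mathrm{Unif}(\mathcal X)$ the uniform distribution on it. The aggregated market is a fixed $x^*\in\mathcal X$. A segmentation is a finitely supported probability distribution $\sigma$ on $\mathcal X$ with $\sum_x\sigma(x)x=x^*$; $\Sigma$ is the set of segmentations. For a price $p\ge0$ and market $x$: $\mathcal U_p(p,x)=p\sum_k x(v_k)\mathbf 1(p\le v_k)$ and $\mathcal U_c(p,x)=\sum_k x(v_k)(v_k-p)\mathbf 1(p\le v_k)$. Privacy mechanism: $\mathcal M_\beta(x)$ equals $x$ with probability $1-\beta$ and, with probability $\beta$, is an independent draw from $\mathrm{Unif}(\mathcal X)$. The producer has prior $\mathrm{Unif}(\mathcal X)$; after observing $\hat x$ the posterior is $\pi_\beta(\cdot|\hat x)=(1-\beta)\delta_{\hat x}+\beta\,\mathrm{Unif}(\mathcal X)$. Put $\mathcal U_p(p|\hat x)=\mathbb E_{x\sim\pi_\beta(\cdot|\hat x)}[\mathcal U_p(p,x)]$. A price $p$ is optimal given $\hat x$ if $\mathcal U_p(p|\hat x)\ge\mathcal U_p(p'|\hat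 x)$ for all $p'\ge0$ (optimal prices lie in $\mathcal V$). An optimal pricing rule is a (measurable) map $\phi:\mathcal X\to\Delta(\mathcal V)$ such that for each $\hat x$ the support of $\phi(\hat x)$ consists only of prices optimal given $\hat x$. For $\bullet\in\{p,c\}$ let $U_\bullet^\phi(x)=\mathbb E_{\hat x\sim\mathcal M_\beta(x)}\mathbb E_{q\sim\phi(\hat x)}[\mathcal U_\bullet(q,x)]$. Then $\mathcal S_\beta$ is the set of pairs $\big(\sum_x\sigma(x)U_c^\phi(x),\ \sum_x\sigma(x)U_p^\phi(x)\big)$ over all $\sigma\in\Sigma$ and all optimal pricing rules $\phi$ (for parameter $\beta$). *)

theory Defs
  imports "HOL-Probability.Probability"
begin

text \<open>
  A distribution on the set of values \<open>v 1 < \<dots> < v K\<close> is encoded as the extensional function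
  \<open>x\<close> on the index set \<open>{1..K}\<close> in which \<open>x k\<close> is the mass of the value \<open>v k\<close>. Hence
  \<open>markets K\<close> is the simplex of markets and also the set of distributions over prices in
  \<open>{v 1, \<dots>, v K}\<close>.
\<close>

definition markets :: "nat \<Rightarrow> (nat \<Rightarrow> real) set" where
  "markets K = {x \<in> {1..K} \<rightarrow>\<^sub>E {0..}. (\<Sum>k\<in>{1..K}. x k) = 1}"

definition market_space :: "nat \<Rightarrow> (nat \<Rightarrow> real) measure" where
  "market_space K = restrict_space (Pi\<^sub>M {1..K} (\<lambda>_. borel)) (markets K)"

text \<open>
  The simplex is null for \<open>K\<close>-dimensional Lebesgue measure. Its uniform distribution is the image
  of normalised \<open>(K - 1)\<close>-dimensional Lebesgue measure on the corner simplex under the affine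
  parametrisation by the first \<open>K - 1\<close> coordinates (affine, hence of constant Jacobian).
\<close>

definition corner :: "nat \<Rightarrow> (nat \<Rightarrow> real) set" where
  "corner K = {y \<in> {1..<K} \<rightarrow>\<^sub>E {0..}. (\<Sum>k\<in>{1..<K}. y k) \<le> 1}"

definition complete_market :: "nat \<Rightarrow> (nat \<Rightarrow> real) \<Rightarrow> nat \<Rightarrow> real" where
  "complete_market K y = (\<lambda>k\<in>{1..K}. if k = K then 1 - (\<Sum>j\<in>{1..<K}. y j) else y k)"

definition unif_market :: "nat \<Rightarrow> (nat \<Rightarrow> real) measure" where
  "unif_market K =
     distr (uniform_measure (restrict_space (Pi\<^sub>M {1..<K} (\<lambda>_. lborel)) (corner K)) (corner K))
       (market_space K) (complete_market K)"

definition producer_utility :: "nat \<Rightarrow> (nat \<Rightarrow> real) \<Rightarrow> real \<Rightarrow> (nat \<Rightarrow> real) \<Rightarrow> real" where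
  "producer_utility K v p x = p * (\<Sum>k\<in>{1..K}. x k * of_bool (p \<le> v k))"

definition consumer_utility :: "nat \<Rightarrow> (nat \<Rightarrow> real) \<Rightarrow> real \<Rightarrow> (nat \<Rightarrow> real) \<Rightarrow> real" where
  "consumer_utility K v p x = (\<Sum>k\<in>{1..K}. x k * (v k - p) * of_bool (p \<le> v k))"

definition segmentations :: "nat \<Rightarrow> (nat \<Rightarrow> real) \<Rightarrow> (nat \<Rightarrow> real) pmf set" where
  "segmentations K xstar =
     {\<sigma>. finite (set_pmf \<sigma>) \<and> set_pmf \<sigma> \<subseteq> markets K \<and>
          (\<forall>k\<in>{1..K}. (\<Sum>x\<in>set_pmf \<sigma>. pmf \<sigma> x * x k) = xstar k)}"

definition mechanism :: "nat \<Rightarrow> real \<Rightarrow> (nat \<Rightarrow> real) \<Rightarrow> (nat \<Rightarrow> real) measure" where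
  "mechanism K \<beta> x =
     measure_pmf (bernoulli_pmf \<beta>) \<bind>
       (\<lambda>resample. if resample then unif_market K else return (market_space K) x)"

text \<open>
  Under the uniform prior, the posterior after observing \<open>xhat\<close> is
  \<open>(1 - \<beta>) \<delta>\<^bsub>xhat\<^esub> + \<beta> Unif\<close>, which as a measure is again the following two-stage mixture.
\<close>

definition posterior :: "nat \<Rightarrow> real \<Rightarrow> (nat \<Rightarrow> real) \<Rightarrow> (nat \<Rightarrow> real) measure" where
  "posterior K \<beta> xhat =
     measure_pmf (bernoulli_pmf \<beta>) \<bind>
       (\<lambda>resampled. if resampled then unif_market K else return (market_space K) xhat)"

definition posterior_utility ::
    "nat \<Rightarrow> (nat \<Rightarrow> real) \<Rightarrow> real \<Rightarrow> real \<Rightarrow> (nat \<Rightarrow> real) \<Rightarrow> real" where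
  "posterior_utility K v \<beta> p xhat = (\<integral>x. producer_utility K v p x \<partial>posterior K \<beta> xhat)"

definition optimal_price ::
    "nat \<Rightarrow> (nat \<Rightarrow> real) \<Rightarrow> real \<Rightarrow> (nat \<Rightarrow> real) \<Rightarrow> real \<Rightarrow> bool" where
  "optimal_price K v \<beta> xhat p \<longleftrightarrow>
     0 \<le> p \<and> (\<forall>p'\<ge>0. posterior_utility K v \<beta> p' xhat \<le> posterior_utility K v \<beta> p xhat)"

text \<open>For a pricing rule \<open>\<phi>\<close>, \<open>\<phi> xhat k\<close> is the probability of charging the price \<open>v k\<close>.\<close>

definition optimal_rules ::
    "nat \<Rightarrow> (nat \<Rightarrow> real) \<Rightarrow> real \<Rightarrow> ((nat \<Rightarrow> real) \<Rightarrow> nat \<Rightarrow> real) set" where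
  "optimal_rules K v \<beta> =
     {\<phi>. \<phi> \<in> market_space K \<rightarrow>\<^sub>M market_space K \<and>
          (\<forall>xhat\<in>markets K. \<forall>k\<in>{1..K}. 0 < \<phi> xhat k \<longrightarrow> optimal_price K v \<beta> xhat (v k))}"

definition expected_utility ::
    "nat \<Rightarrow> (nat \<Rightarrow> real) \<Rightarrow> real \<Rightarrow> ((nat \<Rightarrow> real) \<Rightarrow> nat \<Rightarrow> real) \<Rightarrow>
     (real \<Rightarrow> (nat \<Rightarrow> real) \<Rightarrow> real) \<Rightarrow> (nat \<Rightarrow> real) \<Rightarrow> real" where
  "expected_utility K v \<beta> \<phi> U x =
     (\<integral>xhat. (\<Sum>k\<in>{1..K}. \<phi> xhat k * U (v k) x) \<partial>mechanism K \<beta> x)"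

definition utility_pairs ::
    "nat \<Rightarrow> (nat \<Rightarrow> real) \<Rightarrow> (nat \<Rightarrow> real) \<Rightarrow> real \<Rightarrow> (real \<times> real) set" where
  "utility_pairs K v xstar \<beta> =
     {(\<Sum>x\<in>set_pmf \<sigma>. pmf \<sigma> x * expected_utility K v \<beta> \<phi> (consumer_utility K v) x,
       \<Sum>x\<in>set_pmf \<sigma>. pmf \<sigma> x * expected_utility K v \<beta> \<phi> (producer_utility K v) x) | \<sigma> \<phi>.
        \<sigma> \<in> segmentations K xstar \<and> \<phi> \<in> optimal_rules K v \<beta>}"

text \<open>The library's \<open>Max\<close> is meaningful only for finite sets.\<close>

definition is_maximum :: "real set \<Rightarrow> real \<Rightarrow> bool" where
  "is_maximum A m \<longleftrightarrow> m \<in> A \<and> (\<forall>a\<in>A. a \<le> m)"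

end

theory Submission imports Defs begin

text \<open>
  A price never earns more than the value of each buyer it serves, so no segmentation and pricing
  rule yields more than \<open>\<Sum>k. v k * xstar k\<close>. For \<open>\<beta> = 0\<close>, splitting \<open>xstar\<close> into point masses attains
  this bound, which gives the inequality.

  That the maximum exists for every \<open>\<beta>\<close> is the harder part. The region of signals at which \<open>v k\<close> is
  optimal is convex and the producer utility is linear in the market, so a segment may be recorded
  only through the aggregate \<open>z k\<close> of everything that is charged \<open>v k\<close>. Revenue from unperturbed
  signals thereby becomes a continuous function on a compact polytope. Revenue from resampled signals
  does not depend on the segmentation and is maximised by breaking ties in favour of \<open>xstar\<close>.
  Changing the pricing rule on the finite support of an optimal segmentation does not affect it,
  because the uniform distribution has no atoms.
\<close>

section \<open>The uniform distribution on markets\<close>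

lemma measurable_market_coordinate:
  "k \<in> {1..K} \<Longrightarrow> (\<lambda>x. x k) \<in> borel_measurable (market_space K)"
  unfolding market_space_def
  by (intro measurable_restrict_space1 measurable_component_singleton) auto

lemma space_market_space [simp]: "space (market_space K) = markets K"
  by (auto simp: market_space_def space_restrict_space space_PiM markets_def)

text \<open>The uniform law is built on products of \<open>lborel\<close>, markets carry products of
  \<open>borel\<close>. As a congruence rule this lets measurability proofs pass from one to the
  other.\<close>

lemma sets_PiM_lborel [measurable_cong]:
  "sets (Pi\<^sub>M I (\<lambda>_. lborel :: real measure)) = sets (Pi\<^sub>M I (\<lambda>_. borel))"
  by (intro sets_PiM_cong) auto

lemma corner_measurable: "corner K \<in> sets (Pi\<^sub>M {1..<K} (\<lambda>_. lborel))"
proof -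
  have "corner K = {y \<in> space (Pi\<^sub>M {1..<K} (\<lambda>_. lborel)).
      (\<forall>k\<in>{1..<K}. 0 \<le> y k) \<and> (\<Sum>k\<in>{1..<K}. y k) \<le> 1}"
    by (auto simp: corner_def space_PiM PiE_def Pi_def)
  also have "\<dots> \<in> sets (Pi\<^sub>M {1..<K} (\<lambda>_. lborel))"
    by measurable
  finally show ?thesis .
qed

interpretation lborel_product: product_sigma_finite "\<lambda>_::nat. lborel :: real measure"
  by standard

text \<open>The corner contains a cube of side 1/K, because K - 1 coordinates of size at most 1/K
  sum to at most 1. Together with the finiteness shown next, this makes the normalisation in
  \<open>unif_market\<close> legitimate.\<close>

lemma emeasure_corner_neq_0: "emeasure (Pi\<^sub>M {1..<K} (\<lambda>_. lborel)) (corner K) \<noteq> 0"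
proof
  assume null: "emeasure (Pi\<^sub>M {1..<K} (\<lambda>_. lborel)) (corner K) = 0"
  \<comment> \<open>For K = 0 the side 1/0 evaluates to 0, but then there are no coordinates and the
    volume is the empty product 1.\<close>
  define B where "B = {1..<K} \<rightarrow>\<^sub>E {0..1 / real K}"
  have "B \<subseteq> corner K"
  proof
    fix y assume y: "y \<in> B"
    have "(\<Sum>k\<in>{1..<K}. y k) \<le> (\<Sum>k\<in>{1..<K}. 1 / real K)"
      using y by (intro sum_mono) (auto simp: B_def PiE_iff)
    also have "\<dots> \<le> 1"
      by (auto simp: divide_simps)
    finally show "y \<in> corner K"
      using y by (auto simp: B_def corner_def PiE_iff)
  qed
  then have "emeasure (Pi\<^sub>M {1..<K} (\<lambda>_. lborel)) B \<le> 0"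
    using null corner_measurable[of K] by (metis emeasure_mono)
  moreover have "emeasure (Pi\<^sub>M {1..<K} (\<lambda>_. lborel)) B = (\<Prod>k\<in>{1..<K}. ennreal (1 / real K))"
    unfolding B_def by (subst lborel_product.emeasure_PiM) auto
  ultimately show False
    by (auto simp: prod_ennreal ennreal_eq_0_iff)
qed

lemma emeasure_corner_neq_top: "emeasure (Pi\<^sub>M {1..<K} (\<lambda>_. lborel)) (corner K) \<noteq> \<infinity>"
proof -
  have "corner K \<subseteq> {1..<K} \<rightarrow>\<^sub>E {0..1}"
  proof
    fix y assume y: "y \<in> corner K"
    have "y k \<le> 1" if "k \<in> {1..<K}" for k
      using member_le_sum[of k "{1..<K}" y] y that by (auto simp: corner_def PiE_iff)
    then show "y \<in> {1..<K} \<rightarrow>\<^sub>E {0..1}"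
      using y by (auto simp: corner_def PiE_iff)
  qed
  moreover have "{1..<K} \<rightarrow>\<^sub>E {0..1} \<in> sets (Pi\<^sub>M {1..<K} (\<lambda>_. lborel :: real measure))"
    by (rule sets_PiM_I_finite) auto
  ultimately have "emeasure (Pi\<^sub>M {1..<K} (\<lambda>_. lborel)) (corner K)
      \<le> emeasure (Pi\<^sub>M {1..<K} (\<lambda>_. lborel)) ({1..<K} \<rightarrow>\<^sub>E {0..1 :: real})"
    by (rule emeasure_mono)
  also have "\<dots> = 1"
    by (subst lborel_product.emeasure_PiM) auto
  finally show ?thesis
    by (auto simp: top_unique)
qed

lemma complete_market_in_markets:
  assumes "1 \<le> K" "y \<in> corner K"
  shows "complete_market K y \<in> markets K"
proof -
  have "(\<Sum>k\<in>{1..K}. complete_market K y k)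
      = (\<Sum>k\<in>{1..<K}. complete_market K y k) + complete_market K y K"
    using sum.last_plus[of 1 K "complete_market K y"] assms(1)
    by (simp add: add.commute)
  also have "(\<Sum>k\<in>{1..<K}. complete_market K y k) = (\<Sum>k\<in>{1..<K}. y k)"
    by (intro sum.cong) (auto simp: complete_market_def)
  finally have "(\<Sum>k\<in>{1..K}. complete_market K y k) = 1"
    using assms(1) by (simp add: complete_market_def)
  then show ?thesis
    using assms by (auto simp: markets_def complete_market_def corner_def PiE_iff)
qed

lemma measurable_complete_market:
  assumes "1 \<le> K"
  shows "complete_market K \<in>
    restrict_space (Pi\<^sub>M {1..<K} (\<lambda>_. lborel)) (corner K) \<rightarrow>\<^sub>M market_space K"
  unfolding market_space_def
proof (rule measurable_restrict_space2)
  show "complete_market K \<in> space (restrict_space (Pi\<^sub>M {1..<K} (\<lambda>_. lborel)) (corner K)) \<rightarrow> markets K"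
    using complete_market_in_markets[OF assms] by (auto simp: space_restrict_space)
  show "complete_market K \<in>
      restrict_space (Pi\<^sub>M {1..<K} (\<lambda>_. lborel)) (corner K) \<rightarrow>\<^sub>M Pi\<^sub>M {1..K} (\<lambda>_. borel)"
    unfolding complete_market_def
  proof (intro measurable_restrict_space1 measurable_restrict)
    fix k assume k: "k \<in> {1..K}"
    show "(\<lambda>y. if k = K then 1 - (\<Sum>j\<in>{1..<K}. y j) else y k)
        \<in> borel_measurable (Pi\<^sub>M {1..<K} (\<lambda>_. lborel :: real measure))"
    proof (cases "k = K")
      case False
      then have "(\<lambda>y. y k) \<in> borel_measurable (Pi\<^sub>M {1..<K} (\<lambda>_. lborel :: real measure))"
        using k measurable_component_singleton[of k "{1..<K}" "\<lambda>_. lborel :: real measure"] by simp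
      with False show ?thesis by simp
    qed simp
  qed
qed

lemma prob_space_unif_market:
  assumes "1 \<le> K"
  shows "prob_space (unif_market K)"
proof -
  have eq: "emeasure (restrict_space (Pi\<^sub>M {1..<K} (\<lambda>_. lborel)) (corner K)) (corner K)
      = emeasure (Pi\<^sub>M {1..<K} (\<lambda>_. lborel)) (corner K)"
    using corner_measurable[of K] by (intro emeasure_restrict_space) auto
  interpret u: prob_space "uniform_measure (restrict_space (Pi\<^sub>M {1..<K} (\<lambda>_. lborel)) (corner K)) (corner K)"
    by (rule prob_space_uniform_measure)
       (simp_all only: eq emeasure_corner_neq_0 emeasure_corner_neq_top not_False_eq_True)
  show ?thesis
    unfolding unif_market_def using measurable_complete_market[OF assms]
    by (intro u.prob_space_distr) simp
qed

lemma sets_unif_market [simp, measurable_cong]: "sets (unif_market K) = sets (market_space K)"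
  by (simp add: unif_market_def)

lemma space_unif_market [simp]: "space (unif_market K) = markets K"
  by (simp add: unif_market_def)

lemma singleton_market_measurable:
  assumes "x \<in> markets K"
  shows "{x} \<in> sets (market_space K)"
proof -
  \<comment> \<open>Markets are extensional, so agreement on \<open>{1..K}\<close> is already
    equality.\<close>
  have "{x} = {y \<in> space (market_space K). \<forall>k\<in>{1..K}. y k = x k}"
    using assms by (auto simp: markets_def intro: PiE_ext)
  also have "\<dots> \<in> sets (market_space K)"
    by (intro sets.sets_Collect_finite_All borel_measurable_eq measurable_market_coordinate) auto
  finally show ?thesis .
qed

text \<open>Completing a point of the corner to \<open>x\<close> determines all its coordinates, so
  the preimage of \<open>x\<close> lies in a product of singletons. That product is null since K at
  least 2 leaves at least one factor.\<close>

lemma emeasure_unif_market_singleton: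
  assumes "2 \<le> K" "x \<in> markets K"
  shows "emeasure (unif_market K) {x} = 0"
proof -
  let ?L = "Pi\<^sub>M {1..<K} (\<lambda>_. lborel :: real measure)"
  let ?R = "restrict_space ?L (corner K)"
  define P where "P = complete_market K -` {x} \<inter> space ?R"
  have cm: "complete_market K \<in> ?R \<rightarrow>\<^sub>M market_space K"
    using assms by (intro measurable_complete_market) auto
  have P: "P \<in> sets ?R"
    unfolding P_def using cm singleton_market_measurable[OF assms(2)] by (rule measurable_sets)
  have sub: "P \<subseteq> (\<Pi>\<^sub>E k\<in>{1..<K}. {x k})"
  proof
    fix y assume y: "y \<in> P"
    then have "y k = x k" if "k \<in> {1..<K}" for k
      using that fun_cong[of "complete_market K y" x k] by (auto simp: P_def complete_market_def)
    then show "y \<in> (\<Pi>\<^sub>E k\<in>{1..<K}. {x k})"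
      using y by (auto simp: P_def space_restrict_space corner_def PiE_iff)
  qed
  have "emeasure ?R P = emeasure ?L P"
    using corner_measurable[of K] by (intro emeasure_restrict_space) (auto simp: P_def space_restrict_space)
  also have "\<dots> \<le> emeasure ?L (\<Pi>\<^sub>E k\<in>{1..<K}. {x k})"
    using sub by (intro emeasure_mono) (auto intro!: sets_PiM_I_finite)
  also have "\<dots> = 0"
    using assms(1) by (subst lborel_product.emeasure_PiM) auto
  finally have null: "emeasure ?R P = 0" by simp
  have corner: "corner K \<in> sets ?R"
    using corner_measurable[of K] by (auto simp: sets_restrict_space)
  have "emeasure (unif_market K) {x} = emeasure (uniform_measure ?R (corner K)) P"
    unfolding unif_market_def P_def using cm singleton_market_measurable[OF assms(2)]
    by (subst emeasure_distr) auto
  also have "\<dots> = emeasure ?R (corner K \<inter> P) / emeasure ?R (corner K)"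
    using P corner by simp
  also have "emeasure ?R (corner K \<inter> P) = 0"
    using null P by (metis Int_lower2 emeasure_mono le_zero_eq)
  finally show ?thesis by simp
qed

lemma AE_unif_market_not_in_finite:
  assumes "2 \<le> K" "finite F" "F \<subseteq> markets K"
  shows "AE x in unif_market K. x \<notin> F"
proof -
  have "{x} \<in> null_sets (unif_market K)" if "x \<in> F" for x
    using assms that emeasure_unif_market_singleton singleton_market_measurable by (auto simp: null_sets_def)
  then have "(\<Union>x\<in>F. {x}) \<in> null_sets (unif_market K)"
    using assms(2) by (intro null_sets.finite_UN) auto
  then show ?thesis
    by (intro AE_not_in) simp
qed

section \<open>Utilities and optimal prices\<close>

text \<open>\<open>mechanism\<close> and \<open>posterior\<close> unfold to the same two-stage
  mixture, so one formula serves for both.\<close>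

lemma integral_resample:
  fixes f :: "(nat \<Rightarrow> real) \<Rightarrow> real"
  assumes K: "1 \<le> K" and \<beta>: "\<beta> \<in> {0..1}" and x: "x \<in> markets K"
    and f: "f \<in> borel_measurable (market_space K)" and bd: "\<And>y. y \<in> markets K \<Longrightarrow> \<bar>f y\<bar> \<le> B"
  shows "(\<integral>y. f y \<partial>(measure_pmf (bernoulli_pmf \<beta>) \<bind>
           (\<lambda>resample. if resample then unif_market K else return (market_space K) x)))
       = (1 - \<beta>) * f x + \<beta> * (\<integral>y. f y \<partial>unif_market K)"
proof -
  interpret u: prob_space "unif_market K"
    using K by (rule prob_space_unif_market)
  have ru: "unif_market K \<in> space (subprob_algebra (market_space K))"
    by (auto simp: space_subprob_algebra intro: prob_space_imp_subprob_space u.prob_space_axioms)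
  have rr: "return (market_space K) x \<in> space (subprob_algebra (market_space K))"
    using x by (auto simp: space_subprob_algebra intro!: prob_space_imp_subprob_space prob_space_return)
  have "(\<integral>y. f y \<partial>(measure_pmf (bernoulli_pmf \<beta>) \<bind>
           (\<lambda>resample. if resample then unif_market K else return (market_space K) x)))
     = (\<integral>r. (\<integral>y. f y \<partial>(if r then unif_market K else return (market_space K) x)) \<partial>bernoulli_pmf \<beta>)"
    using f bd ru rr x
    by (intro integral_bind[where K = "market_space K" and B' = 1 and B = B])
       (auto simp: space_subprob_algebra subprob_space.subprob_emeasure_le_1 u.emeasure_space_1
          emeasure_return u.finite_measure_axioms intro!: measure_pmf.finite_measure_axioms u.emeasure_le_1)
  also have "\<dots> = (1 - \<beta>) * f x + \<beta> * (\<integral>y. f y \<partial>unif_market K)"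
    using \<beta> f x by (subst integral_bernoulli_pmf) (auto simp: integral_return)
  finally show ?thesis .
qed

lemma producer_utility_cong:
  assumes "\<And>k. k \<in> {1..K} \<Longrightarrow> x k = y k"
  shows "producer_utility K v p x = producer_utility K v p y"
  using assms by (simp add: producer_utility_def)

text \<open>Linearity is stated for arbitrary functions and coefficients, since it is also applied
  to unnormalised aggregates of segments.\<close>

lemma producer_utility_sum:
  "producer_utility K v p (\<lambda>i. \<Sum>a\<in>A. c a * f a i) = (\<Sum>a\<in>A. c a * producer_utility K v p (f a))"
proof -
  have "producer_utility K v p (\<lambda>i. \<Sum>a\<in>A. c a * f a i)
      = (\<Sum>k\<in>{1..K}. \<Sum>a\<in>A. p * (c a * f a k * of_bool (p \<le> v k)))"
    by (simp add: producer_utility_def sum_distrib_left sum_distrib_right mult.assoc)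
  also have "\<dots> = (\<Sum>a\<in>A. \<Sum>k\<in>{1..K}. p * (c a * f a k * of_bool (p \<le> v k)))"
    by (rule sum.swap)
  also have "\<dots> = (\<Sum>a\<in>A. c a * producer_utility K v p (f a))"
    unfolding producer_utility_def sum_distrib_left by (intro sum.cong refl) (simp add: mult_ac)
  finally show ?thesis .
qed

lemma measurable_producer_utility:
  "producer_utility K v p \<in> borel_measurable (market_space K)"
  unfolding producer_utility_def
  by (intro borel_measurable_times borel_measurable_sum borel_measurable_const measurable_market_coordinate)

lemma market_le_1:
  assumes "x \<in> markets K" "k \<in> {1..K}"
  shows "x k \<le> 1"
  using member_le_sum[of k "{1..K}" x] assms by (auto simp: markets_def PiE_iff)

lemma market_nonneg: "x \<in> markets K \<Longrightarrow> k \<in> {1..K} \<Longrightarrow> 0 \<le> x k"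
  by (auto simp: markets_def PiE_iff)

section \<open>Finitely supported distributions with prescribed weights\<close>

lemma finite_pmf_exists:
  fixes w :: "'a \<Rightarrow> real"
  assumes "finite A" "\<And>a. a \<in> A \<Longrightarrow> 0 \<le> w a" "(\<Sum>a\<in>A. w a) = 1"
  obtains p :: "'a pmf" where "set_pmf p \<subseteq> A" "\<And>a. a \<in> A \<Longrightarrow> pmf p a = w a"
proof -
  define f where "f a = (if a \<in> A then w a else 0)" for a
  have nonneg: "0 \<le> f a" for a
    using assms by (auto simp: f_def)
  have "(\<integral>\<^sup>+a. ennreal (f a) \<partial>count_space UNIV) = (\<Sum>a\<in>A. ennreal (f a))"
    using assms(1) by (intro nn_integral_count_space') (auto simp: f_def)
  also have "\<dots> = 1"
    using assms by (subst sum_ennreal) (auto simp: f_def)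
  finally have total: "(\<integral>\<^sup>+a. ennreal (f a) \<partial>count_space UNIV) = 1" .
  show ?thesis
  proof
    show "set_pmf (embed_pmf f) \<subseteq> A"
      by (subst set_embed_pmf[OF nonneg total]) (auto simp: f_def)
    show "pmf (embed_pmf f) a = w a" if "a \<in> A" for a
      using that by (subst pmf_embed_pmf[OF nonneg total]) (auto simp: f_def)
  qed
qed

text \<open>\<open>g\<close> may send several indices to one point, as when aggregates for different
  prices normalise to the same market. Passing through the integral adds up their weights; indices
  of \<open>A\<close> outside the support weigh 0.\<close>

lemma sum_map_pmf:
  fixes f :: "'b \<Rightarrow> real"
  assumes "finite A" "set_pmf p \<subseteq> A"
  shows "(\<Sum>x\<in>set_pmf (map_pmf g p). pmf (map_pmf g p) x * f x) = (\<Sum>a\<in>A. pmf p a * f (g a))"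
proof -
  have "(\<Sum>x\<in>set_pmf (map_pmf g p). pmf (map_pmf g p) x * f x) = (\<integral>x. f x \<partial>map_pmf g p)"
    using finite_subset[OF assms(2,1)]
    by (subst integral_measure_pmf_real[of "set_pmf (map_pmf g p)"]) (auto simp: mult.commute)
  also have "\<dots> = (\<Sum>a\<in>A. pmf p a * f (g a))"
    using assms by (simp, subst integral_measure_pmf_real[of A]) (auto simp: mult.commute)
  finally show ?thesis .
qed

lemma return_pmf_segmentation: "xstar \<in> markets K \<Longrightarrow> return_pmf xstar \<in> segmentations K xstar"
  by (simp add: segmentations_def)

text \<open>The final comparison needs these facts for a general \<open>\<beta>\<close> and for 0,
  so the parameter is fixed in a locale that is interpreted twice.\<close>

locale private_pricing =
  fixes K :: nat and v :: "nat \<Rightarrow> real" and \<beta> :: real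
  assumes K: "2 \<le> K" and v_1: "0 < v 1" and v_mono: "strict_mono_on {1..K} v" and \<beta>: "\<beta> \<in> {0..1}"
begin

sublocale unif: prob_space "unif_market K"
  using K by (intro prob_space_unif_market) simp

abbreviation U :: "real \<Rightarrow> (nat \<Rightarrow> real) \<Rightarrow> real" where
  "U \<equiv> producer_utility K v"

lemma v_le: "j \<in> {1..K} \<Longrightarrow> k \<in> {1..K} \<Longrightarrow> j \<le> k \<Longrightarrow> v j \<le> v k"
  using strict_mono_on_leD[OF v_mono] by blast

lemma v_pos: "k \<in> {1..K} \<Longrightarrow> 0 < v k"
  using v_le[of 1 k] v_1 by auto

lemma U_nonneg: "0 \<le> p \<Longrightarrow> (\<And>k. k \<in> {1..K} \<Longrightarrow> 0 \<le> x k) \<Longrightarrow> 0 \<le> U p x"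
  unfolding producer_utility_def by (intro mult_nonneg_nonneg sum_nonneg) auto

text \<open>Buyers of value \<open>v k\<close> pay either nothing or a price of at most
  \<open>v k\<close>.\<close>

lemma U_le_expected_value:
  assumes "\<And>k. k \<in> {1..K} \<Longrightarrow> 0 \<le> x k"
  shows "U p x \<le> (\<Sum>k\<in>{1..K}. v k * x k)"
  unfolding producer_utility_def sum_distrib_left
proof (rule sum_mono)
  fix k assume k: "k \<in> {1..K}"
  show "p * (x k * of_bool (p \<le> v k)) \<le> v k * x k"
    using assms[OF k] v_pos[OF k] by (auto intro: mult_right_mono)
qed

lemma abs_U_le:
  assumes "x \<in> markets K" "0 \<le> p"
  shows "\<bar>U p x\<bar> \<le> v K"
proof -
  have "U p x \<le> (\<Sum>k\<in>{1..K}. v k * x k)"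
    using assms by (intro U_le_expected_value market_nonneg)
  also have "\<dots> \<le> (\<Sum>k\<in>{1..K}. v K * x k)"
    using assms(1) K by (intro sum_mono mult_right_mono v_le market_nonneg) auto
  also have "\<dots> = v K"
    using assms(1) by (simp add: sum_distrib_left[symmetric] markets_def)
  finally show ?thesis
    using U_nonneg[OF assms(2), of x] market_nonneg[OF assms(1)] by auto
qed

text \<open>Raising a price to the next value loses no buyer, and a price above \<open>v K\<close>
  sells nothing. The same index \<open>j\<close> works for every market, so the comparison can be
  integrated against the prior.\<close>

lemma price_rounding:
  assumes "0 \<le> p"
  shows "\<exists>j\<in>{1..K}. \<forall>x\<in>markets K. U p x \<le> U (v j) x"
proof (cases "\<exists>k\<in>{1..K}. p \<le> v k")
  case True
  define j where "j = (LEAST k. k \<in> {1..K} \<and> p \<le> v k)"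
  have "\<exists>k. k \<in> {1..K} \<and> p \<le> v k"
    using True by blast
  then have j: "j \<in> {1..K} \<and> p \<le> v j"
    unfolding j_def by (rule LeastI_ex)
  have *: "v j \<le> v k" if "k \<in> {1..K}" "p \<le> v k" for k
    using that j by (intro v_le) (auto simp: j_def intro: Least_le)
  have "U p x \<le> U (v j) x" if x: "x \<in> markets K" for x
    unfolding producer_utility_def
  proof (rule mult_mono)
    show "(\<Sum>k\<in>{1..K}. x k * of_bool (p \<le> v k)) \<le> (\<Sum>k\<in>{1..K}. x k * of_bool (v j \<le> v k))"
    proof (rule sum_mono)
      fix k assume k: "k \<in> {1..K}"
      show "x k * of_bool (p \<le> v k) \<le> x k * of_bool (v j \<le> v k)"
        using market_nonneg[OF x k] *[OF k] by auto
    qed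
    show "0 \<le> (\<Sum>k\<in>{1..K}. x k * of_bool (p \<le> v k))"
      using market_nonneg[OF x] by (intro sum_nonneg) auto
  qed (use j v_pos[of j] in auto)
  with j show ?thesis by blast
next
  case False
  then have "U p x = 0" for x
    by (simp add: producer_utility_def)
  moreover have "0 \<le> U (v K) x" if "x \<in> markets K" for x
    using that v_pos[of K] K market_nonneg by (intro U_nonneg) auto
  ultimately show ?thesis
    using K by (intro bexI[of _ K]) auto
qed

lemma posterior_utility_eq:
  assumes "0 \<le> p" "x \<in> markets K"
  shows "posterior_utility K v \<beta> p x = (1 - \<beta>) * U p x + \<beta> * (\<integral>y. U p y \<partial>unif_market K)"
  unfolding posterior_utility_def posterior_def
  using K \<beta> assms by (intro integral_resample[where B = "v K"] abs_U_le measurable_producer_utility) auto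

text \<open>The posterior utility of price \<open>v k\<close>, extended homogeneously to unnormalised markets, so
  that the optimality regions become polyhedral cones.\<close>

definition score :: "nat \<Rightarrow> (nat \<Rightarrow> real) \<Rightarrow> real" where
  "score k x = (1 - \<beta>) * U (v k) x + \<beta> * (\<integral>y. U (v k) y \<partial>unif_market K) * (\<Sum>i\<in>{1..K}. x i)"

definition best :: "nat \<Rightarrow> (nat \<Rightarrow> real) \<Rightarrow> bool" where
  "best k x \<longleftrightarrow> k \<in> {1..K} \<and> (\<forall>j\<in>{1..K}. score j x \<le> score k x)"

lemma score_cong:
  assumes "\<And>k. k \<in> {1..K} \<Longrightarrow> x k = y k"
  shows "score k x = score k y"
  using assms producer_utility_cong[of K x y v "v k"] by (simp add: score_def)

text \<open>The factor of total mass in the prior term makes \<open>score\<close> linear instead of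
  affine. Score inequalities therefore survive nonnegative combinations and rescaling, and on a
  market, whose mass is 1, \<open>score\<close> is the posterior utility.\<close>

lemma score_sum: "score k (\<lambda>i. \<Sum>a\<in>A. c a * f a i) = (\<Sum>a\<in>A. c a * score k (f a))"
proof -
  have "(\<Sum>i\<in>{1..K}. \<Sum>a\<in>A. c a * f a i) = (\<Sum>a\<in>A. c a * (\<Sum>i\<in>{1..K}. f a i))"
    by (subst sum.swap) (simp add: sum_distrib_left)
  moreover have "(\<Sum>a\<in>A. c a * (r * g a + e * h a)) = r * (\<Sum>a\<in>A. c a * g a) + e * (\<Sum>a\<in>A. c a * h a)"
    for r e :: real and g h
    by (simp add: sum_distrib_left sum.distrib algebra_simps)
  ultimately show ?thesis
    by (simp only: score_def producer_utility_sum)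
qed

lemma score_eq_posterior_utility:
  assumes "x \<in> markets K" "k \<in> {1..K}"
  shows "score k x = posterior_utility K v \<beta> (v k) x"
  using assms v_pos[of k] by (subst posterior_utility_eq) (auto simp: score_def markets_def)

text \<open>By \<open>price_rounding\<close>, any competing price is dominated by some
  \<open>v j\<close> both at the observed market and in prior expectation, so only the K values have
  to be compared.\<close>

lemma optimal_price_iff_best:
  assumes x: "x \<in> markets K" and k: "k \<in> {1..K}"
  shows "optimal_price K v \<beta> x (v k) \<longleftrightarrow> best k x"
proof
  assume "optimal_price K v \<beta> x (v k)"
  then show "best k x"
    using x k v_pos by (auto simp: optimal_price_def best_def score_eq_posterior_utility less_imp_le)
next
  assume best: "best k x"
  have "posterior_utility K v \<beta> p x \<le> posterior_utility K v \<beta> (v k) x" if p: "0 \<le> p" for p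
  proof -
    obtain j where j: "j \<in> {1..K}" "\<And>y. y \<in> markets K \<Longrightarrow> U p y \<le> U (v j) y"
      using price_rounding[OF p] by blast
    have int: "integrable (unif_market K) (U q)" if "0 \<le> q" for q
      using that measurable_producer_utility[of K v q] abs_U_le
      by (intro unif.integrable_const_bound[where B = "v K"]) auto
    have "(\<integral>y. U p y \<partial>unif_market K) \<le> (\<integral>y. U (v j) y \<partial>unif_market K)"
      using j p v_pos[of j] by (intro integral_mono int) auto
    then have "posterior_utility K v \<beta> p x \<le> posterior_utility K v \<beta> (v j) x"
      using j p x \<beta> v_pos[of j] by (subst (1 2) posterior_utility_eq) (auto intro!: add_mono mult_left_mono)
    also have "\<dots> \<le> posterior_utility K v \<beta> (v k) x"
      using best j x k by (simp add: best_def score_eq_posterior_utility[symmetric])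
    finally show ?thesis .
  qed
  then show "optimal_price K v \<beta> x (v k)"
    using v_pos[OF k] by (auto simp: optimal_price_def)
qed

section \<open>Measurable selection among optimal prices\<close>

lemma best_exists: "\<exists>k. best k x"
proof -
  define m where "m = Max ((\<lambda>k. score k x) ` {1..K})"
  have "m \<in> (\<lambda>k. score k x) ` {1..K}"
    unfolding m_def using K by (intro Max_in) auto
  then obtain k where "k \<in> {1..K}" "score k x = m"
    by auto
  moreover have "score j x \<le> m" if "j \<in> {1..K}" for j
    unfolding m_def using that by (intro Max_ge) auto
  ultimately show ?thesis
    by (auto simp: best_def)
qed

lemma measurable_score: "score k \<in> borel_measurable (market_space K)"
  unfolding score_def
  by (intro borel_measurable_add borel_measurable_times borel_measurable_sum borel_measurable_const
      measurable_producer_utility measurable_market_coordinate)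

lemma measurable_best: "Measurable.pred (market_space K) (best k)"
  unfolding best_def Measurable.pred_def
  by (intro sets.sets_Collect_conj sets.sets_Collect_const sets.sets_Collect_finite_All borel_measurable_le
      measurable_score) auto

text \<open>Breaks ties among optimal prices in favour of a criterion \<open>h\<close> that may vary
  with the market. Taking the least maximising index keeps the choice measurable.\<close>

lemma measurable_best_selection:
  assumes h: "\<And>k. k \<in> {1..K} \<Longrightarrow> h k \<in> borel_measurable (market_space K)"
  obtains s where "s \<in> market_space K \<rightarrow>\<^sub>M count_space UNIV" "\<And>x. best (s x) x"
    "\<And>x k. best k x \<Longrightarrow> h k x \<le> (h (s x) x :: real)"
proof -
  \<comment> \<open>\<open>LEAST\<close> ranges over all naturals, so the criterion needs a
    measurable value at every index; 0 is a default outside \<open>{1..K}\<close>.\<close>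
  define h' where "h' k = (if k \<in> {1..K} then h k else (\<lambda>_. 0))" for k
  have h': "h' k \<in> borel_measurable (market_space K)" for k
    using h by (simp add: h'_def)
  define P where "P k x \<longleftrightarrow> best k x \<and> (\<forall>j\<in>{1..K}. best j x \<longrightarrow> h' j x \<le> h' k x)" for k x
  have ex: "\<exists>k. P k x" for x
  proof -
    have fin: "finite {k. best k x}"
      by (rule finite_subset[of _ "{1..K}"]) (auto simp: best_def)
    define m where "m = Max ((\<lambda>k. h' k x) ` {k. best k x})"
    have "m \<in> (\<lambda>k. h' k x) ` {k. best k x}"
      unfolding m_def using best_exists[of x] fin by (intro Max_in) auto
    then obtain k where k: "best k x" "h' k x = m"
      by auto
    have "h' j x \<le> m" if "best j x" for j
      unfolding m_def using fin that by (intro Max_ge) auto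
    with k show ?thesis
      by (auto simp: P_def)
  qed
  define s where "s x = (LEAST k. P k x)" for x
  have s: "P (s x) x" for x
    unfolding s_def using ex by (rule LeastI_ex)
  show ?thesis
  proof
    show "s \<in> market_space K \<rightarrow>\<^sub>M count_space UNIV"
      unfolding s_def P_def
      by (intro measurable_Least pred_intros_logic pred_intros_finite measurable_best
          borel_measurable_le[folded Measurable.pred_def] h') auto
    show "best (s x) x" for x
      using s by (auto simp: P_def)
    show "h k x \<le> h (s x) x" if "best k x" for x k
      using s[of x] that by (auto simp: P_def h'_def best_def)
  qed
qed

definition pure_rule :: "((nat \<Rightarrow> real) \<Rightarrow> nat) \<Rightarrow> (nat \<Rightarrow> real) \<Rightarrow> nat \<Rightarrow> real" where
  "pure_rule s x = (\<lambda>k\<in>{1..K}. of_bool (k = s x))"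

lemma sum_pure_rule:
  assumes "s x \<in> {1..K}"
  shows "(\<Sum>k\<in>{1..K}. pure_rule s x k * f k) = f (s x)"
proof -
  have "(\<Sum>k\<in>{1..K}. pure_rule s x k * f k) = (\<Sum>k\<in>{1..K}. if k = s x then f k else 0)"
    by (intro sum.cong) (auto simp: pure_rule_def)
  with assms show ?thesis by simp
qed

lemma pure_rule_optimal:
  assumes s: "s \<in> market_space K \<rightarrow>\<^sub>M count_space UNIV" and best: "\<And>x. best (s x) x"
  shows "pure_rule s \<in> optimal_rules K v \<beta>"
proof -
  have range: "s x \<in> {1..K}" for x
    using best by (auto simp: best_def)
  have "pure_rule s x \<in> markets K" for x
    using sum_pure_rule[of s x "\<lambda>_. 1", OF range] by (auto simp: markets_def pure_rule_def)
  moreover have "pure_rule s \<in> market_space K \<rightarrow>\<^sub>M Pi\<^sub>M {1..K} (\<lambda>_. borel)"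
    unfolding pure_rule_def
    by (intro measurable_restrict measurable_compose[OF s]) auto
  ultimately have "pure_rule s \<in> market_space K \<rightarrow>\<^sub>M market_space K"
    by (subst (2) market_space_def, intro measurable_restrict_space2) auto
  then show ?thesis
    using best optimal_price_iff_best by (auto simp: optimal_rules_def pure_rule_def split: if_splits)
qed

section \<open>Revenue of optimal pricing rules\<close>

lemma optimal_rule_in_markets:
  "\<phi> \<in> optimal_rules K v \<beta> \<Longrightarrow> x \<in> markets K \<Longrightarrow> \<phi> x \<in> markets K"
  using measurable_space[of \<phi> "market_space K" "market_space K" x] by (simp add: optimal_rules_def)

lemma measurable_optimal_rule:
  "\<phi> \<in> optimal_rules K v \<beta> \<Longrightarrow> k \<in> {1..K} \<Longrightarrow> (\<lambda>y. \<phi> y k) \<in> borel_measurable (market_space K)"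
  by (auto simp: optimal_rules_def intro: measurable_compose[OF _ measurable_market_coordinate])

lemma integrable_optimal_rule:
  assumes "\<phi> \<in> optimal_rules K v \<beta>" "k \<in> {1..K}"
  shows "integrable (unif_market K) (\<lambda>y. \<phi> y k)"
proof (rule unif.integrable_const_bound[where B = 1])
  show "AE y in unif_market K. norm (\<phi> y k) \<le> 1"
  proof (rule AE_I2)
    fix y assume "y \<in> space (unif_market K)"
    then have "\<phi> y \<in> markets K"
      using assms(1) by (simp add: optimal_rule_in_markets)
    from market_nonneg[OF this assms(2)] market_le_1[OF this assms(2)]
    show "norm (\<phi> y k) \<le> 1" by simp
  qed
  show "(\<lambda>y. \<phi> y k) \<in> borel_measurable (unif_market K)"
    using measurable_optimal_rule[OF assms] by (simp add: measurable_cong_sets[OF sets_unif_market refl])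
qed

text \<open>An optimal rule puts mass on best indices only, so a bound on those bounds the
  average.\<close>

lemma optimal_rule_mixture_le:
  assumes \<phi>: "\<phi> \<in> optimal_rules K v \<beta>" and x: "x \<in> markets K"
    and le: "\<And>k. best k x \<Longrightarrow> f k \<le> m"
  shows "(\<Sum>k\<in>{1..K}. \<phi> x k * f k) \<le> m"
proof -
  have \<phi>x: "\<phi> x \<in> markets K"
    using \<phi> x by (rule optimal_rule_in_markets)
  have "(\<Sum>k\<in>{1..K}. \<phi> x k * f k) \<le> (\<Sum>k\<in>{1..K}. \<phi> x k * m)"
  proof (rule sum_mono)
    fix k assume k: "k \<in> {1..K}"
    show "\<phi> x k * f k \<le> \<phi> x k * m"
    proof (cases "\<phi> x k = 0")
      case False
      then have "0 < \<phi> x k"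
        using market_nonneg[OF \<phi>x k] by simp
      moreover from this have "best k x"
        using \<phi> x k optimal_price_iff_best[OF x k] by (auto simp: optimal_rules_def)
      ultimately show ?thesis
        using le by simp
    qed simp
  qed
  also have "\<dots> = m"
    using \<phi>x by (simp add: sum_distrib_right[symmetric] markets_def)
  finally show ?thesis .
qed

text \<open>The coefficients of the resampling term are the mean probabilities of each price. They
  do not depend on \<open>x\<close>, so this term is linear in the true market.\<close>

lemma expected_utility_eq:
  assumes \<phi>: "\<phi> \<in> optimal_rules K v \<beta>" and x: "x \<in> markets K"
  shows "expected_utility K v \<beta> \<phi> U x = (1 - \<beta>) * (\<Sum>k\<in>{1..K}. \<phi> x k * U (v k) x)
           + \<beta> * (\<Sum>k\<in>{1..K}. (\<integral>y. \<phi> y k \<partial>unif_market K) * U (v k) x)"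
proof -
  have "expected_utility K v \<beta> \<phi> U x = (1 - \<beta>) * (\<Sum>k\<in>{1..K}. \<phi> x k * U (v k) x)
      + \<beta> * (\<integral>y. (\<Sum>k\<in>{1..K}. \<phi> y k * U (v k) x) \<partial>unif_market K)"
    unfolding expected_utility_def mechanism_def
  proof (rule integral_resample[where B = "\<Sum>k\<in>{1..K}. \<bar>U (v k) x\<bar>"])
    show "(\<lambda>y. \<Sum>k\<in>{1..K}. \<phi> y k * U (v k) x) \<in> borel_measurable (market_space K)"
      by (intro borel_measurable_sum borel_measurable_times borel_measurable_const measurable_optimal_rule[OF \<phi>])
    fix y assume y: "y \<in> markets K"
    have \<phi>y: "\<phi> y \<in> markets K"
      using \<phi> y by (rule optimal_rule_in_markets)
    have "\<bar>\<Sum>k\<in>{1..K}. \<phi> y k * U (v k) x\<bar> \<le> (\<Sum>k\<in>{1..K}. \<bar>\<phi> y k * U (v k) x\<bar>)"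
      by (rule sum_abs)
    also have "\<dots> \<le> (\<Sum>k\<in>{1..K}. \<bar>U (v k) x\<bar>)"
      using market_nonneg[OF \<phi>y] market_le_1[OF \<phi>y]
      by (intro sum_mono) (auto simp: abs_mult intro!: mult_left_le_one_le)
    finally show "\<bar>\<Sum>k\<in>{1..K}. \<phi> y k * U (v k) x\<bar> \<le> (\<Sum>k\<in>{1..K}. \<bar>U (v k) x\<bar>)" .
  qed (use K \<beta> x in auto)
  also have "(\<integral>y. (\<Sum>k\<in>{1..K}. \<phi> y k * U (v k) x) \<partial>unif_market K)
      = (\<Sum>k\<in>{1..K}. (\<integral>y. \<phi> y k \<partial>unif_market K) * U (v k) x)"
    using integrable_optimal_rule[OF \<phi>] by (subst Bochner_Integration.integral_sum) auto
  finally show ?thesis .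
qed

abbreviation revenue :: "(nat \<Rightarrow> real) pmf \<Rightarrow> ((nat \<Rightarrow> real) \<Rightarrow> nat \<Rightarrow> real) \<Rightarrow> real" where
  "revenue \<sigma> \<phi> \<equiv> \<Sum>x\<in>set_pmf \<sigma>. pmf \<sigma> x * expected_utility K v \<beta> \<phi> U x"

text \<open>Linearity in the market makes the revenue from resampled signals independent of the
  segmentation.\<close>

lemma revenue_eq:
  assumes \<sigma>: "\<sigma> \<in> segmentations K xstar" and \<phi>: "\<phi> \<in> optimal_rules K v \<beta>"
  shows "revenue \<sigma> \<phi> = (1 - \<beta>) * (\<Sum>x\<in>set_pmf \<sigma>. pmf \<sigma> x * (\<Sum>k\<in>{1..K}. \<phi> x k * U (v k) x))
           + \<beta> * (\<integral>y. (\<Sum>k\<in>{1..K}. \<phi> y k * U (v k) xstar) \<partial>unif_market K)"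
proof -
  define c where "c k = (\<integral>y. \<phi> y k \<partial>unif_market K)" for k
  have xstar: "(\<Sum>x\<in>set_pmf \<sigma>. pmf \<sigma> x * U p x) = U p xstar" for p
  proof -
    have "(\<Sum>x\<in>set_pmf \<sigma>. pmf \<sigma> x * U p x) = U p (\<lambda>i. \<Sum>x\<in>set_pmf \<sigma>. pmf \<sigma> x * x i)"
      by (rule producer_utility_sum[symmetric])
    also have "\<dots> = U p xstar"
      using \<sigma> by (intro producer_utility_cong) (simp add: segmentations_def)
    finally show ?thesis .
  qed
  have "revenue \<sigma> \<phi> = (\<Sum>x\<in>set_pmf \<sigma>. (1 - \<beta>) * (pmf \<sigma> x * (\<Sum>k\<in>{1..K}. \<phi> x k * U (v k) x))
      + \<beta> * (pmf \<sigma> x * (\<Sum>k\<in>{1..K}. c k * U (v k) x)))"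
    using \<sigma> \<phi> by (intro sum.cong refl, subst expected_utility_eq)
      (auto simp: segmentations_def c_def algebra_simps)
  also have "\<dots> = (1 - \<beta>) * (\<Sum>x\<in>set_pmf \<sigma>. pmf \<sigma> x * (\<Sum>k\<in>{1..K}. \<phi> x k * U (v k) x))
      + \<beta> * (\<Sum>x\<in>set_pmf \<sigma>. pmf \<sigma> x * (\<Sum>k\<in>{1..K}. c k * U (v k) x))"
    by (simp only: sum.distrib sum_distrib_left)
  \<comment> \<open>After swapping the sums, each price meets the segmentation only through its
    average, which is \<open>xstar\<close>.\<close>
  also have "(\<Sum>x\<in>set_pmf \<sigma>. pmf \<sigma> x * (\<Sum>k\<in>{1..K}. c k * U (v k) x))
      = (\<Sum>k\<in>{1..K}. c k * (\<Sum>x\<in>set_pmf \<sigma>. pmf \<sigma> x * U (v k) x))"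
    unfolding sum_distrib_left by (subst sum.swap) (intro sum.cong refl, simp add: mult_ac)
  also have "\<dots> = (\<integral>y. (\<Sum>k\<in>{1..K}. \<phi> y k * U (v k) xstar) \<partial>unif_market K)"
    unfolding xstar c_def using integrable_optimal_rule[OF \<phi>]
    by (subst Bochner_Integration.integral_sum) auto
  finally show ?thesis .
qed

section \<open>Optimal tie-breaking and the compact set of allocations\<close>

definition best_value :: "(nat \<Rightarrow> real) \<Rightarrow> (nat \<Rightarrow> real) \<Rightarrow> real" where
  "best_value f x = Max (f ` {k. best k x})"

lemma finite_best: "finite {k. best k x}"
  by (rule finite_subset[of _ "{1..K}"]) (auto simp: best_def)

lemma best_value_ge: "best k x \<Longrightarrow> f k \<le> best_value f x"
  unfolding best_value_def using finite_best by (intro Max_ge) auto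

lemma best_value_eqI: "best k x \<Longrightarrow> (\<And>j. best j x \<Longrightarrow> f j \<le> f k) \<Longrightarrow> best_value f x = f k"
  unfolding best_value_def using finite_best by (intro Max_eqI) auto

text \<open>The set over which the maximum is taken varies with the market. Measurability comes from
  writing the maximum as \<open>f\<close> composed with a measurable selection.\<close>

lemma integrable_best_value: "integrable (unif_market K) (best_value f)"
proof -
  obtain s where s: "s \<in> market_space K \<rightarrow>\<^sub>M count_space UNIV" "\<And>x. best (s x) x"
    "\<And>x k. best k x \<Longrightarrow> f k \<le> f (s x)"
    using measurable_best_selection[of "\<lambda>k _. f k"] by auto
  have eq: "best_value f = (\<lambda>x. f (s x))"
    using s by (intro ext best_value_eqI) auto
  have "s x \<in> {1..K}" for x
    using s(2)[of x] by (simp add: best_def)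
  then have "\<bar>f (s x)\<bar> \<le> (\<Sum>k\<in>{1..K}. \<bar>f k\<bar>)" for x
    by (intro member_le_sum) auto
  moreover have "(\<lambda>x. f (s x)) \<in> borel_measurable (unif_market K)"
    using measurable_compose[OF s(1), of f borel] by (simp add: measurable_cong_sets[OF sets_unif_market refl])
  ultimately show ?thesis
    unfolding eq by (intro unif.integrable_const_bound[where B = "\<Sum>k\<in>{1..K}. \<bar>f k\<bar>"]) auto
qed

text \<open>The largest conditional revenue that an optimal rule can earn from a resampled signal:
  the bound holds pointwise and is reached by breaking ties in favour of
  \<open>xstar\<close>.\<close>

definition resampled_revenue :: "(nat \<Rightarrow> real) \<Rightarrow> real" where
  "resampled_revenue xstar = (\<integral>y. best_value (\<lambda>k. U (v k) xstar) y \<partial>unif_market K)"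

text \<open>\<open>z k\<close> is the unnormalised aggregate of the segments that are charged \<open>v k\<close>. Values
  outside \<open>{1..K}\<close> are pinned to 0 so that the set of allocations is compact.\<close>

definition allocations :: "(nat \<Rightarrow> real) \<Rightarrow> (nat \<Rightarrow> nat \<Rightarrow> real) set" where
  "allocations xstar = {z. (\<forall>k i. 0 \<le> z k i) \<and> (\<forall>k i. k \<notin> {1..K} \<or> i \<notin> {1..K} \<longrightarrow> z k i = 0) \<and>
     (\<forall>i\<in>{1..K}. (\<Sum>k\<in>{1..K}. z k i) = xstar i) \<and> (\<forall>k\<in>{1..K}. best k (z k))}"

definition allocation_revenue :: "(nat \<Rightarrow> nat \<Rightarrow> real) \<Rightarrow> real" where
  "allocation_revenue z = (\<Sum>k\<in>{1..K}. U (v k) (z k))"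

lemma allocation_le:
  assumes "z \<in> allocations xstar" "k \<in> {1..K}" "i \<in> {1..K}"
  shows "z k i \<le> xstar i"
proof -
  have "z k i \<le> (\<Sum>k\<in>{1..K}. z k i)"
    using assms by (intro member_le_sum[of k "{1..K}" "\<lambda>k. z k i"]) (auto simp: allocations_def)
  with assms show ?thesis
    by (simp add: allocations_def)
qed

text \<open>Every entry is at most \<open>xstar i\<close>, hence at most 1, so allocations lie in a
  product of compact intervals. The remaining conditions are equations and weak inequalities between
  continuous functions, so they cut out a closed subset.\<close>

lemma compact_allocations:
  assumes "xstar \<in> markets K"
  shows "compact (allocations xstar)"
proof -
  define box :: "(nat \<Rightarrow> nat \<Rightarrow> real) set"
    where "box = (\<Pi>\<^sub>E k\<in>UNIV. \<Pi>\<^sub>E i\<in>UNIV. if k \<in> {1..K} \<and> i \<in> {1..K} then {0..1} else {0})"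
  \<comment> \<open>Tychonoff's theorem, used once for each of the two indices of
    \<open>z\<close>.\<close>
  have PiE: "compact (Pi\<^sub>E UNIV S)" if "\<And>i. compact (S i)" for S :: "nat \<Rightarrow> 'b::topological_space set"
    using compactin_PiE[of "\<lambda>_. euclidean" UNIV S] that by (simp add: euclidean_product_topology)
  have "compact box"
    unfolding box_def by (intro PiE) auto
  have cont: "continuous_on UNIV (\<lambda>z :: nat \<Rightarrow> nat \<Rightarrow> real. z k i)" for k i
    by (intro continuous_on_product_then_coordinatewise[of _ "\<lambda>z. z k" i] continuous_on_product_coordinates)
  have score: "continuous_on UNIV (\<lambda>z :: nat \<Rightarrow> nat \<Rightarrow> real. score j (z k))" for j k
    unfolding score_def producer_utility_def by (intro continuous_intros cont)
  have "allocations xstar = box \<inter> (\<Inter>i\<in>{1..K}. {z. (\<Sum>k\<in>{1..K}. z k i) = xstar i}) \<inter>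
      (\<Inter>k\<in>{1..K}. \<Inter>j\<in>{1..K}. {z. score j (z k) \<le> score k (z k)})"
  proof (intro set_eqI iffI)
    fix z assume z: "z \<in> allocations xstar"
    have "z k i \<le> 1" if "k \<in> {1..K}" "i \<in> {1..K}" for k i
      using allocation_le[OF z that] market_le_1[OF assms that(2)] by simp
    with z show "z \<in> box \<inter> (\<Inter>i\<in>{1..K}. {z. (\<Sum>k\<in>{1..K}. z k i) = xstar i}) \<inter>
        (\<Inter>k\<in>{1..K}. \<Inter>j\<in>{1..K}. {z. score j (z k) \<le> score k (z k)})"
      by (auto simp: allocations_def box_def best_def)
  next
    fix z assume "z \<in> box \<inter> (\<Inter>i\<in>{1..K}. {z. (\<Sum>k\<in>{1..K}. z k i) = xstar i}) \<inter>
        (\<Inter>k\<in>{1..K}. \<Inter>j\<in>{1..K}. {z. score j (z k) \<le> score k (z k)})"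
    moreover from this have box: "z k i \<in> (if k \<in> {1..K} \<and> i \<in> {1..K} then {0..1} else {0})" for k i
      unfolding box_def by (fastforce simp: PiE_iff)
    have "0 \<le> z k i" for k i
      using box[of k i] by (auto split: if_splits)
    moreover have "z k i = 0" if "k \<notin> {1..K} \<or> i \<notin> {1..K}" for k i
      using box[of k i] that by (auto split: if_splits)
    ultimately show "z \<in> allocations xstar"
      by (auto simp: allocations_def best_def)
  qed
  also have "compact \<dots>"
    unfolding Int_assoc
    by (intro compact_Int_closed \<open>compact box\<close> closed_Int closed_INT ballI closed_Collect_eq
        closed_Collect_le continuous_intros cont score)
  finally show ?thesis .
qed

lemma continuous_on_allocation_revenue: "continuous_on S allocation_revenue"
proof -
  have "continuous_on UNIV (\<lambda>z :: nat \<Rightarrow> nat \<Rightarrow> real. z k i)" for k i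
    by (intro continuous_on_product_then_coordinatewise[of _ "\<lambda>z. z k" i] continuous_on_product_coordinates)
  then have "continuous_on UNIV allocation_revenue"
    unfolding allocation_revenue_def producer_utility_def by (intro continuous_intros)
  then show ?thesis
    by (rule continuous_on_subset) auto
qed

section \<open>Reduction to a compact set of allocations\<close>

lemma revenue_le_allocation:
  assumes \<sigma>: "\<sigma> \<in> segmentations K xstar" and \<phi>: "\<phi> \<in> optimal_rules K v \<beta>"
  shows "\<exists>z\<in>allocations xstar.
    revenue \<sigma> \<phi> \<le> (1 - \<beta>) * allocation_revenue z + \<beta> * resampled_revenue xstar"
proof
  \<comment> \<open>Each segment contributes to \<open>z k\<close> with its weight times the
    probability that it is charged \<open>v k\<close>.\<close>
  define z where "z k i = (if k \<in> {1..K} \<and> i \<in> {1..K}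
    then \<Sum>x\<in>set_pmf \<sigma>. pmf \<sigma> x * \<phi> x k * x i else 0)" for k i
  have x: "x \<in> markets K" "\<phi> x \<in> markets K" if "x \<in> set_pmf \<sigma>" for x
    using \<sigma> that optimal_rule_in_markets[OF \<phi>] by (auto simp: segmentations_def)
  have score_z: "score j (z k) = (\<Sum>x\<in>set_pmf \<sigma>. pmf \<sigma> x * \<phi> x k * score j x)" if "k \<in> {1..K}" for j k
    using that by (subst score_sum[symmetric]) (auto intro!: score_cong simp: z_def)
  have U_z: "U p (z k) = (\<Sum>x\<in>set_pmf \<sigma>. pmf \<sigma> x * \<phi> x k * U p x)" if "k \<in> {1..K}" for p k
    using that by (subst producer_utility_sum[symmetric]) (auto intro!: producer_utility_cong simp: z_def)
  have "best k (z k)" if k: "k \<in> {1..K}" for k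
    unfolding best_def
  proof (intro conjI ballI k)
    fix j assume j: "j \<in> {1..K}"
    show "score j (z k) \<le> score k (z k)"
      unfolding score_z[OF k]
    proof (rule sum_mono)
      fix y assume y: "y \<in> set_pmf \<sigma>"
      \<comment> \<open>Either \<open>v k\<close> is never charged at \<open>y\<close> and both
        sides vanish, or it is optimal there.\<close>
      have "\<phi> y k * score j y \<le> \<phi> y k * score k y"
      proof (cases "\<phi> y k = 0")
        case False
        then have pos: "0 < \<phi> y k"
          using market_nonneg[OF x(2)[OF y] k] by simp
        then have "best k y"
          using \<phi> x(1)[OF y] k optimal_price_iff_best by (auto simp: optimal_rules_def)
        with pos j show ?thesis
          by (simp add: best_def)
      qed simp
      then show "pmf \<sigma> y * \<phi> y k * score j y \<le> pmf \<sigma> y * \<phi> y k * score k y"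
        unfolding mult.assoc by (rule mult_left_mono) simp
    qed
  qed
  moreover have "0 \<le> z k i" for k i
    using market_nonneg[OF x(1)] market_nonneg[OF x(2)]
    by (auto simp: z_def intro!: sum_nonneg mult_nonneg_nonneg)
  moreover have "(\<Sum>k\<in>{1..K}. z k i) = xstar i" if i: "i \<in> {1..K}" for i
  proof -
    have "(\<Sum>k\<in>{1..K}. z k i) = (\<Sum>k\<in>{1..K}. \<Sum>x\<in>set_pmf \<sigma>. pmf \<sigma> x * x i * \<phi> x k)"
      using i by (intro sum.cong) (auto simp: z_def mult_ac)
    also have "\<dots> = (\<Sum>x\<in>set_pmf \<sigma>. pmf \<sigma> x * x i * (\<Sum>k\<in>{1..K}. \<phi> x k))"
      by (subst sum.swap) (simp add: sum_distrib_left)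
    also have "\<dots> = (\<Sum>x\<in>set_pmf \<sigma>. pmf \<sigma> x * x i)"
      using x(2) by (intro sum.cong) (auto simp: markets_def)
    finally show ?thesis
      using \<sigma> i by (simp add: segmentations_def)
  qed
  ultimately show "z \<in> allocations xstar"
    unfolding allocations_def by (auto simp: z_def)
  have "allocation_revenue z
      = (\<Sum>k\<in>{1..K}. \<Sum>x\<in>set_pmf \<sigma>. pmf \<sigma> x * (\<phi> x k * U (v k) x))"
    unfolding allocation_revenue_def by (intro sum.cong refl) (simp only: U_z mult.assoc)
  also have "\<dots> = (\<Sum>x\<in>set_pmf \<sigma>. pmf \<sigma> x * (\<Sum>k\<in>{1..K}. \<phi> x k * U (v k) x))"
    by (subst sum.swap) (simp only: sum_distrib_left)
  finally have "(\<Sum>x\<in>set_pmf \<sigma>. pmf \<sigma> x * (\<Sum>k\<in>{1..K}. \<phi> x k * U (v k) x)) = allocation_revenue z" ..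
  moreover have "(\<integral>y. (\<Sum>k\<in>{1..K}. \<phi> y k * U (v k) xstar) \<partial>unif_market K) \<le> resampled_revenue xstar"
    unfolding resampled_revenue_def
  proof (rule integral_mono)
    show "integrable (unif_market K) (\<lambda>y. \<Sum>k\<in>{1..K}. \<phi> y k * U (v k) xstar)"
      using integrable_optimal_rule[OF \<phi>] by (intro Bochner_Integration.integrable_sum) auto
    show "(\<Sum>k\<in>{1..K}. \<phi> y k * U (v k) xstar) \<le> best_value (\<lambda>k. U (v k) xstar) y"
      if "y \<in> space (unif_market K)" for y
      using that \<phi> best_value_ge by (intro optimal_rule_mixture_le) auto
  qed (rule integrable_best_value)
  ultimately show "revenue \<sigma> \<phi> \<le> (1 - \<beta>) * allocation_revenue z + \<beta> * resampled_revenue xstar"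
    using \<beta> by (subst revenue_eq[OF \<sigma> \<phi>]) (auto intro: mult_left_mono)
qed

text \<open>Each aggregate \<open>z k\<close> is normalised to a market \<open>y k\<close> of weight
  \<open>w k\<close>, and the rule breaks ties for the true segment on this finite support and for
  \<open>xstar\<close> elsewhere. Only an inequality is claimed: the selected price at
  \<open>y k\<close> may differ from \<open>v k\<close>, but it earns at least as much.\<close>

lemma allocation_attained:
  assumes xstar: "xstar \<in> markets K" and z: "z \<in> allocations xstar"
  shows "\<exists>\<sigma>\<in>segmentations K xstar. \<exists>\<phi>\<in>optimal_rules K v \<beta>.
    (1 - \<beta>) * allocation_revenue z + \<beta> * resampled_revenue xstar \<le> revenue \<sigma> \<phi>"
proof -
  define w where "w k = (\<Sum>i\<in>{1..K}. z k i)" for k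
  \<comment> \<open>An aggregate of mass 0 cannot be normalised; \<open>xstar\<close> stands in as a
    market of weight 0.\<close>
  define y where "y k = (if w k = 0 then xstar else (\<lambda>i\<in>{1..K}. z k i / w k))" for k
  have z_nonneg: "0 \<le> z k i" for k i
    using z by (simp add: allocations_def)
  have w_nonneg: "0 \<le> w k" for k
    unfolding w_def using z_nonneg by (intro sum_nonneg) auto
  have "(\<Sum>k\<in>{1..K}. w k) = (\<Sum>i\<in>{1..K}. \<Sum>k\<in>{1..K}. z k i)"
    unfolding w_def by (rule sum.swap)
  also have "\<dots> = 1"
    using z xstar by (simp add: allocations_def markets_def)
  finally have w_sum: "(\<Sum>k\<in>{1..K}. w k) = 1" .
  have w_0: "z k i = 0" if "w k = 0" "i \<in> {1..K}" for k i
    using that z_nonneg by (simp add: w_def sum_nonneg_eq_0_iff)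
  have y_market: "y k \<in> markets K" for k
    using xstar z_nonneg w_nonneg
    by (auto simp: y_def markets_def sum_divide_distrib[symmetric] w_def)
  have z_eq: "z k i = w k * y k i" if "i \<in> {1..K}" for k i
    using that w_0[of k i] by (auto simp: y_def)
  obtain p where p: "set_pmf p \<subseteq> {1..K}" "\<And>k. k \<in> {1..K} \<Longrightarrow> pmf p k = w k"
    using finite_pmf_exists[of "{1..K}" w] w_nonneg w_sum by auto
  define \<sigma> where "\<sigma> = map_pmf y p"
  have sum_\<sigma>: "(\<Sum>x\<in>set_pmf \<sigma>. pmf \<sigma> x * f x) = (\<Sum>k\<in>{1..K}. w k * f (y k))" for f
    unfolding \<sigma>_def using p by (subst sum_map_pmf[of "{1..K}"]) auto
  have fin: "finite (set_pmf \<sigma>)"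
    unfolding \<sigma>_def using finite_subset[OF p(1)] by simp
  have supp: "set_pmf \<sigma> \<subseteq> markets K"
    unfolding \<sigma>_def using y_market by auto
  have \<sigma>: "\<sigma> \<in> segmentations K xstar"
    unfolding segmentations_def
  proof (intro CollectI conjI ballI fin supp)
    fix i assume i: "i \<in> {1..K}"
    have "(\<Sum>x\<in>set_pmf \<sigma>. pmf \<sigma> x * x i) = (\<Sum>k\<in>{1..K}. w k * y k i)"
      by (rule sum_\<sigma>)
    also have "\<dots> = (\<Sum>k\<in>{1..K}. z k i)"
      using i by (simp add: z_eq)
    finally show "(\<Sum>x\<in>set_pmf \<sigma>. pmf \<sigma> x * x i) = xstar i"
      using z i by (simp add: allocations_def)
  qed
  \<comment> \<open>Unperturbed signals from the segmentation reveal the market that is really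
    served; for the other signals, revenue is judged at \<open>xstar\<close>.\<close>
  define h where "h k x = (if x \<in> set_pmf \<sigma> then U (v k) x else U (v k) xstar)" for k x
  have "(\<Union>x\<in>set_pmf \<sigma>. {x}) \<in> sets (market_space K)"
    using fin supp singleton_market_measurable by (intro sets.finite_UN) auto
  then have "Measurable.pred (market_space K) (\<lambda>x. x \<in> set_pmf \<sigma>)"
    by (intro pred_sets2[OF _ measurable_ident_sets[OF refl], unfolded id_def]) simp
  then have "h k \<in> borel_measurable (market_space K)" for k
    unfolding h_def by (intro measurable_If measurable_producer_utility borel_measurable_const)
      (simp add: Measurable.pred_def)
  then obtain s where s: "s \<in> market_space K \<rightarrow>\<^sub>M count_space UNIV" "\<And>x. best (s x) x"
    "\<And>x k. best k x \<Longrightarrow> h k x \<le> h (s x) x"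
    using measurable_best_selection[of h] by auto
  have s_range: "s x \<in> {1..K}" for x
    using s(2)[of x] by (simp add: best_def)
  define \<phi> where "\<phi> = pure_rule s"
  have \<phi>: "\<phi> \<in> optimal_rules K v \<beta>"
    unfolding \<phi>_def using s by (intro pure_rule_optimal) auto
  have sum_\<phi>: "(\<Sum>k\<in>{1..K}. \<phi> x k * f k) = f (s x)" for x f
    unfolding \<phi>_def by (intro sum_pure_rule s_range)
  have "(\<integral>x. (\<Sum>k\<in>{1..K}. \<phi> x k * U (v k) xstar) \<partial>unif_market K) = resampled_revenue xstar"
    unfolding resampled_revenue_def
  proof (rule integral_cong_AE)
    \<comment> \<open>A resampled signal almost surely misses the finite support, and off the
      support the rule maximises revenue at \<open>xstar\<close>.\<close>
    show "AE x in unif_market K. (\<Sum>k\<in>{1..K}. \<phi> x k * U (v k) xstar) = best_value (\<lambda>k. U (v k) xstar) x"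
      using AE_unif_market_not_in_finite[OF K fin supp]
    proof eventually_elim
      case (elim x)
      then show ?case
        unfolding sum_\<phi> using s(3)[of _ x] s(2) by (intro best_value_eqI[symmetric]) (auto simp: h_def)
    qed
    show "(\<lambda>x. \<Sum>k\<in>{1..K}. \<phi> x k * U (v k) xstar) \<in> borel_measurable (unif_market K)"
      unfolding measurable_cong_sets[OF sets_unif_market refl]
      by (intro borel_measurable_sum borel_measurable_times borel_measurable_const measurable_optimal_rule[OF \<phi>])
  qed (rule borel_measurable_integrable[OF integrable_best_value])
  moreover have "allocation_revenue z
      \<le> (\<Sum>x\<in>set_pmf \<sigma>. pmf \<sigma> x * (\<Sum>k\<in>{1..K}. \<phi> x k * U (v k) x))"
    unfolding sum_\<phi> sum_\<sigma> allocation_revenue_def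
  proof (rule sum_mono)
    fix k assume k: "k \<in> {1..K}"
    \<comment> \<open>Homogeneity is read off from linearity over a one-element index set, here and
      for \<open>score\<close>.\<close>
    have U_z: "U q (z k) = w k * U q (y k)" for q
      using producer_utility_sum[of K v q "\<lambda>_. w k" "\<lambda>_. y k" "{()}"]
        producer_utility_cong[of K "z k" "\<lambda>i. w k * y k i" v q] z_eq by simp
    have score_z: "score j (z k) = w k * score j (y k)" for j
      using score_sum[of j "\<lambda>_. w k" "\<lambda>_. y k" "{()}"]
        score_cong[of "z k" "\<lambda>i. w k * y k i" j] z_eq by simp
    show "U (v k) (z k) \<le> w k * U (v (s (y k))) (y k)"
    proof (cases "w k = 0")
      case False
      then have w: "0 < w k"
        using w_nonneg[of k] by simp
      have "best k (z k)"
        using z k by (simp add: allocations_def)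
      \<comment> \<open>The positive factor \<open>w k\<close> cancels from all score
        inequalities.\<close>
      then have "best k (y k)"
        using w by (simp add: best_def score_z)
      moreover have "y k \<in> set_pmf \<sigma>"
        unfolding \<sigma>_def using p(2)[OF k] False by (auto simp: set_pmf_iff intro!: imageI)
      ultimately show ?thesis
        using s(3)[of k "y k"] w by (simp add: h_def U_z)
    qed (simp add: U_z)
  qed
  ultimately have "(1 - \<beta>) * allocation_revenue z + \<beta> * resampled_revenue xstar \<le> revenue \<sigma> \<phi>"
    using \<beta> by (subst revenue_eq[OF \<sigma> \<phi>]) (auto intro: mult_left_mono)
  with \<sigma> \<phi> show ?thesis by blast
qed

section \<open>Existence of the maximum, and comparison through the full surplus\<close>

lemma optimal_rules_nonempty: "optimal_rules K v \<beta> \<noteq> {}"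
proof -
  obtain s where "s \<in> market_space K \<rightarrow>\<^sub>M count_space UNIV" "\<And>x. best (s x) x"
    using measurable_best_selection[of "\<lambda>_ _. 0"] by auto
  then show ?thesis
    using pure_rule_optimal by blast
qed

text \<open>The bound by allocations is increasing in their revenue, so a revenue-maximal allocation
  bounds every pair of segmentation and rule. The pair built from it reaches this bound.\<close>

lemma revenue_maximum:
  assumes xstar: "xstar \<in> markets K"
  shows "\<exists>m. is_maximum {u_p. \<exists>u_c. (u_c, u_p) \<in> utility_pairs K v xstar \<beta>} m"
proof -
  have revenues: "{u_p. \<exists>u_c. (u_c, u_p) \<in> utility_pairs K v xstar \<beta>}
      = {revenue \<sigma> \<phi> |\<sigma> \<phi>. \<sigma> \<in> segmentations K xstar \<and> \<phi> \<in> optimal_rules K v \<beta>}"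
    by (auto simp: utility_pairs_def)
  \<comment> \<open>The segmentation consisting of \<open>xstar\<close> alone, with any optimal
    rule, yields an allocation.\<close>
  have "allocations xstar \<noteq> {}"
    using optimal_rules_nonempty revenue_le_allocation[OF return_pmf_segmentation[OF xstar]] by blast
  then obtain z where z: "z \<in> allocations xstar"
    and max: "\<And>z'. z' \<in> allocations xstar \<Longrightarrow> allocation_revenue z' \<le> allocation_revenue z"
    using continuous_attains_sup[OF compact_allocations[OF xstar] _ continuous_on_allocation_revenue] by blast
  have upper: "revenue \<sigma> \<phi> \<le> (1 - \<beta>) * allocation_revenue z + \<beta> * resampled_revenue xstar"
    if in_sets: "\<sigma> \<in> segmentations K xstar" "\<phi> \<in> optimal_rules K v \<beta>" for \<sigma> \<phi>
  proof -
    obtain z' where z': "z' \<in> allocations xstar"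
      "revenue \<sigma> \<phi> \<le> (1 - \<beta>) * allocation_revenue z' + \<beta> * resampled_revenue xstar"
      using revenue_le_allocation[OF in_sets] by blast
    have "(1 - \<beta>) * allocation_revenue z' \<le> (1 - \<beta>) * allocation_revenue z"
      using max[OF z'(1)] \<beta> by (intro mult_left_mono) auto
    with z'(2) show ?thesis by linarith
  qed
  obtain \<sigma> \<phi> where "\<sigma> \<in> segmentations K xstar" "\<phi> \<in> optimal_rules K v \<beta>"
    "(1 - \<beta>) * allocation_revenue z + \<beta> * resampled_revenue xstar \<le> revenue \<sigma> \<phi>"
    using allocation_attained[OF xstar z] by blast
  then have "is_maximum {revenue \<sigma> \<phi> |\<sigma> \<phi>. \<sigma> \<in> segmentations K xstar \<and> \<phi> \<in> optimal_rules K v \<beta>}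
      (revenue \<sigma> \<phi>)"
    unfolding is_maximum_def using upper by fastforce
  then show ?thesis
    unfolding revenues by blast
qed

text \<open>Both the unperturbed and the resampled part are at most the full surplus, and their
  weights add up to 1.\<close>

lemma revenue_le_expected_value:
  assumes \<sigma>: "\<sigma> \<in> segmentations K xstar" and \<phi>: "\<phi> \<in> optimal_rules K v \<beta>" and xstar: "xstar \<in> markets K"
  shows "revenue \<sigma> \<phi> \<le> (\<Sum>i\<in>{1..K}. v i * xstar i)" (is "_ \<le> ?E")
proof -
  obtain z where z: "z \<in> allocations xstar"
    and le: "revenue \<sigma> \<phi> \<le> (1 - \<beta>) * allocation_revenue z + \<beta> * resampled_revenue xstar"
    using revenue_le_allocation[OF \<sigma> \<phi>] by blast
  have "allocation_revenue z \<le> (\<Sum>k\<in>{1..K}. \<Sum>i\<in>{1..K}. v i * z k i)"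
    unfolding allocation_revenue_def using z by (intro sum_mono U_le_expected_value) (auto simp: allocations_def)
  also have "\<dots> = (\<Sum>i\<in>{1..K}. v i * (\<Sum>k\<in>{1..K}. z k i))"
    by (subst sum.swap) (simp add: sum_distrib_left)
  also have "\<dots> = ?E"
    using z by (simp add: allocations_def)
  finally have "allocation_revenue z \<le> ?E" .
  moreover have "resampled_revenue xstar \<le> ?E"
    unfolding resampled_revenue_def
  proof (rule unif.integral_le_const[OF integrable_best_value], rule AE_I2)
    have "U p xstar \<le> ?E" for p
      by (intro U_le_expected_value market_nonneg[OF xstar])
    then show "best_value (\<lambda>k. U (v k) xstar) y \<le> ?E" for y
      unfolding best_value_def using finite_best best_exists by (intro Max.boundedI) auto
  qed
  ultimately have "(1 - \<beta>) * allocation_revenue z + \<beta> * resampled_revenue xstar \<le> (1 - \<beta>) * ?E + \<beta> * ?E"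
    using \<beta> by (intro add_mono mult_left_mono) auto
  with le show ?thesis
    by (simp add: algebra_simps)
qed

lemma full_extraction:
  assumes "\<beta> = 0" and xstar: "xstar \<in> markets K"
  shows "\<exists>\<sigma>\<in>segmentations K xstar. \<exists>\<phi>\<in>optimal_rules K v \<beta>.
    (\<Sum>i\<in>{1..K}. v i * xstar i) \<le> revenue \<sigma> \<phi>"
proof -
  \<comment> \<open>Perfect discrimination: the k-th aggregate consists of exactly the buyers of
    value \<open>v k\<close>.\<close>
  define z :: "nat \<Rightarrow> nat \<Rightarrow> real" where "z k i = (if k \<in> {1..K} \<and> i = k then xstar k else 0)" for k i
  have U_z: "U p (z k) = p * xstar k * of_bool (p \<le> v k)" if "k \<in> {1..K}" for p k
  proof -
    have "U p (z k) = p * (\<Sum>i\<in>{1..K}. if i = k then xstar k * of_bool (p \<le> v k) else 0)"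
      unfolding producer_utility_def using that by (intro arg_cong2[of _ _ _ _ times] sum.cong) (auto simp: z_def)
    with that show ?thesis by simp
  qed
  \<comment> \<open>With \<open>\<beta> = 0\<close> the prior term disappears. Against buyers of the
    single value \<open>v k\<close>, revenue grows with the price up to \<open>v k\<close> and is 0
    beyond it.\<close>
  have "best k (z k)" if k: "k \<in> {1..K}" for k
    unfolding best_def score_def U_z[OF k]
    using k market_nonneg[OF xstar k] v_pos[OF k] assms(1) by (auto intro!: mult_right_mono)
  moreover have "(\<Sum>k\<in>{1..K}. z k i) = xstar i" if "i \<in> {1..K}" for i
  proof -
    have "(\<Sum>k\<in>{1..K}. z k i) = (\<Sum>k\<in>{1..K}. if i = k then xstar k else 0)"
      by (intro sum.cong) (auto simp: z_def)
    with that show ?thesis by simp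
  qed
  ultimately have "z \<in> allocations xstar"
    using market_nonneg[OF xstar] by (auto simp: allocations_def z_def)
  moreover have "allocation_revenue z = (\<Sum>i\<in>{1..K}. v i * xstar i)"
    unfolding allocation_revenue_def by (intro sum.cong) (auto simp: U_z)
  ultimately show ?thesis
    using allocation_attained[OF xstar, of z] assms(1) by simp
qed

end

theorem fact1:
  fixes K :: nat and v :: "nat \<Rightarrow> real" and xstar :: "nat \<Rightarrow> real" and \<beta> :: real
  assumes "2 \<le> K"
    and "0 < v 1" and "strict_mono_on {1..K} v"
    and "xstar \<in> markets K"
    and "\<beta> \<in> {0..1}"
  shows "\<exists>m m0. is_maximum {u_p. \<exists>u_c. (u_c, u_p) \<in> utility_pairs K v xstar \<beta>} m \<and>
                is_maximum {u_p. \<exists>u_c. (u_c, u_p) \<in> utility_pairs K v xstar 0} m0 \<and>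
                m \<le> m0"
proof -
  interpret noisy: private_pricing K v \<beta>
    using assms by unfold_locales
  interpret exact: private_pricing K v 0
    using assms by unfold_locales auto
  obtain m where m: "is_maximum {u_p. \<exists>u_c. (u_c, u_p) \<in> utility_pairs K v xstar \<beta>} m"
    using noisy.revenue_maximum[OF assms(4)] by blast
  obtain m0 where m0: "is_maximum {u_p. \<exists>u_c. (u_c, u_p) \<in> utility_pairs K v xstar 0} m0"
    using exact.revenue_maximum[OF assms(4)] by blast
  obtain \<sigma> \<phi> where "\<sigma> \<in> segmentations K xstar" "\<phi> \<in> optimal_rules K v \<beta>" "m = noisy.revenue \<sigma> \<phi>"
    using m by (auto simp: is_maximum_def utility_pairs_def)
  \<comment> \<open>The full surplus separates the two maxima: it bounds the first from above and is
    attained in the non-private case.\<close>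
  then have "m \<le> (\<Sum>i\<in>{1..K}. v i * xstar i)"
    using noisy.revenue_le_expected_value assms(4) by simp
  also obtain \<sigma>0 \<phi>0 where "\<sigma>0 \<in> segmentations K xstar" "\<phi>0 \<in> optimal_rules K v 0"
    and "(\<Sum>i\<in>{1..K}. v i * xstar i) \<le> exact.revenue \<sigma>0 \<phi>0"
    using exact.full_extraction[OF refl assms(4)] by blast
  note this(3)
  also have "exact.revenue \<sigma>0 \<phi>0 \<le> m0"
    using m0 \<open>\<sigma>0 \<in> segmentations K xstar\<close> \<open>\<phi>0 \<in> optimal_rules K v 0\<close>
    by (auto simp: is_maximum_def utility_pairs_def)
  finally show ?thesis
    using m m0 by blast
qed

end
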